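(* Let $n\ge 2$, let $z_1,z_2,\ldots,z_n$ be $n$, not necessarily distinct, complex numbers, and let $\gamma_1,\ldots,\gamma_n$ be nonnegative real numbers with $\sum_{k=1}^n\gamma_k=1$. Then all the zeros of the polynomial $A_n^\gamma(z)=\sum_{k=1}^n\gamma_k g_k(z)$ lie in the disk $$\left|z-\frac{\sum_{j=1}^{n}(1-\gamma_j)z_j}{n-1}\right|\le \sqrt{\frac{n-2}{n-1}}\left(\sum_{j=1}^{n-1}\left|(1-\gamma_j)z_j+\gamma_{j}z_n\right|^2+(n-2)\sum_{j=1}^{n-1}\gamma_j^2\left|z_n-z_j\right|^2-\frac{\left|\sum_{j=1}^{n}(1-\gamma_j)z_j\right|^2}{n-1}\right)^{\frac12}.$$
   Context: The incomplete polynomials associated with $z_1,\ldots,z_n$ are $g_k(z)=\prod_{j=1,\,j\ne k}^n(z-z_j)$, $1\le k\le n$. *)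

theory Defs
  imports Complex_Main "HOL-Computational_Algebra.Polynomial"
begin

text \<open>The points are \<open>z 1, \<dots>, z n\<close>; values of \<open>z\<close> and \<open>\<gamma>\<close> outside \<open>{1..n}\<close> are irrelevant.\<close>

definition incomplete_poly :: "nat \<Rightarrow> (nat \<Rightarrow> complex) \<Rightarrow> nat \<Rightarrow> complex poly" where
  "incomplete_poly n z k = (\<Prod>j\<in>{1..n} - {k}. [:- z j, 1:])"

definition weighted_incomplete_poly ::
    "nat \<Rightarrow> (nat \<Rightarrow> real) \<Rightarrow> (nat \<Rightarrow> complex) \<Rightarrow> complex poly" where
  "weighted_incomplete_poly n \<gamma> z = (\<Sum>k=1..n. smult (of_real (\<gamma> k)) (incomplete_poly n z k))"

end

theory Submission
  imports Defs "HOL-Analysis.L2_Norm"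
begin

text \<open>
  Put \<open>m = n - 1\<close>. The polynomial is the characteristic polynomial of the \<open>m \<times> m\<close> matrix
  \<open>M = diag(z\<^sub>1, \<dots>, z\<^sub>m) + b 1\<^sup>T\<close> with \<open>b\<^sub>j = \<gamma>\<^sub>j (z\<^sub>n - z\<^sub>j)\<close>, whose trace and Frobenius norm are the
  sums in the bound. If \<open>v\<close> is a unit eigenvector for \<open>w\<close>, then \<open>w - tr M / m\<close> is the Frobenius inner
  product of the traceless part of \<open>M\<close> with \<open>v v\<^sup>* - I / m\<close>, a matrix of squared norm \<open>(m - 1) / m\<close>,
  so the bound is an instance of the Cauchy--Schwarz inequality.
\<close>

lemma Cauchy_Schwarz_sum_norm:
  fixes a b :: "'a \<Rightarrow> complex"
  shows "(cmod (\<Sum>i\<in>A. a i * b i))\<^sup>2 \<le> (\<Sum>i\<in>A. (cmod (a i))\<^sup>2) * (\<Sum>i\<in>A. (cmod (b i))\<^sup>2)"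
proof -
  have "cmod (\<Sum>i\<in>A. a i * b i) \<le> (\<Sum>i\<in>A. \<bar>cmod (a i)\<bar> * \<bar>cmod (b i)\<bar>)"
    by (rule order_trans[OF norm_sum]) (simp add: norm_mult)
  also have "\<dots> \<le> L2_set (\<lambda>i. cmod (a i)) A * L2_set (\<lambda>i. cmod (b i)) A"
    by (rule L2_set_mult_ineq)
  finally have "(cmod (\<Sum>i\<in>A. a i * b i))\<^sup>2
      \<le> (L2_set (\<lambda>i. cmod (a i)) A * L2_set (\<lambda>i. cmod (b i)) A)\<^sup>2"
    by (intro power_mono) auto
  then show ?thesis
    by (simp add: L2_set_def power_mult_distrib sum_nonneg)
qed

text \<open>The bracketing isolates the correction to the square of \<open>a\<close>; when the
  traceless part of \<open>M\<close> is expanded, this correction survives only on the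
  diagonal.\<close>

lemma cmod_diff_squared_cnj: "(cmod (a - b))\<^sup>2 = (cmod a)\<^sup>2 + ((cmod b)\<^sup>2 - 2 * Re (cnj b * a))"
  unfolding cmod_power2 by (simp add: power2_eq_square algebra_simps)

lemma eigenvalue_dist_trace:
  fixes M :: "'a \<Rightarrow> 'a \<Rightarrow> complex" and v :: "'a \<Rightarrow> complex"
  assumes fin: "finite I"
    and eigen: "\<And>j. j \<in> I \<Longrightarrow> (\<Sum>k\<in>I. M j k * v k) = w * v j"
    and nonzero: "\<exists>j\<in>I. v j \<noteq> 0"
  defines "m \<equiv> real (card I)"
  shows "(cmod (w - (\<Sum>j\<in>I. M j j) / of_real m))\<^sup>2
    \<le> (m - 1) / m * ((\<Sum>j\<in>I. \<Sum>k\<in>I. (cmod (M j k))\<^sup>2) - (cmod (\<Sum>j\<in>I. M j j))\<^sup>2 / m)"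
proof -
  define tr where "tr = (\<Sum>j\<in>I. M j j)"
  define t where "t = tr / of_real m"
  define S where "S = (\<Sum>j\<in>I. (cmod (v j))\<^sup>2)"
  define L where "L j k = M j k - (if j = k then t else 0)" for j k
  \<comment> \<open>Dividing by \<open>S\<close> turns the rank-one part into the orthogonal
    projection onto the line of \<open>v\<close>, so \<open>v\<close> need not be a unit
    vector.\<close>
  define Q where "Q j k = v j * cnj (v k) / of_real S - (if j = k then 1 / of_real m else 0)" for j k
  have m: "m > 0"
    using nonzero fin by (auto simp: m_def card_gt_0_iff)
  have S: "S > 0"
    using nonzero fin unfolding S_def by (auto intro: sum_pos2)
  have tr: "tr = of_real m * t"
    using m by (simp add: t_def)
  have L_trace: "(\<Sum>j\<in>I. L j j) = 0"
    by (simp add: L_def sum_subtractf tr_def[symmetric] tr m_def)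
  have L_eigen: "(\<Sum>k\<in>I. L j k * v k) = (w - t) * v j" if "j \<in> I" for j
  proof -
    have "(\<Sum>k\<in>I. L j k * v k) = (\<Sum>k\<in>I. M j k * v k - (if j = k then t * v k else 0))"
      by (intro sum.cong) (auto simp: L_def algebra_simps)
    then show ?thesis
      using that fin by (simp add: sum_subtractf eigen left_diff_distrib)
  qed
  \<comment> \<open>The projection part contributes \<open>v* L v / S\<close>, which is
    \<open>w - t\<close> because \<open>v\<close> is an eigenvector of \<open>L\<close>; the scalar
    part contributes a multiple of the trace of \<open>L\<close>, hence nothing.\<close>
  have inner: "(\<Sum>j\<in>I. \<Sum>k\<in>I. cnj (Q j k) * L j k) = w - t"
  proof -
    have "(\<Sum>k\<in>I. cnj (Q j k) * L j k)
        = (w - t) / of_real S * of_real ((cmod (v j))\<^sup>2) - L j j / of_real m" if "j \<in> I" for j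
    proof -
      have "(\<Sum>k\<in>I. cnj (Q j k) * L j k)
          = (\<Sum>k\<in>I. cnj (v j) / of_real S * (L j k * v k) - (if j = k then L j k / of_real m else 0))"
        by (intro sum.cong) (auto simp: Q_def algebra_simps)
      also have "\<dots> = cnj (v j) / of_real S * ((w - t) * v j) - L j j / of_real m"
        unfolding L_eigen[OF that, symmetric] sum_distrib_left
        using that fin by (simp add: sum_subtractf)
      finally show ?thesis
        by (simp add: complex_norm_square mult_ac del: of_real_power)
    qed
    then have "(\<Sum>j\<in>I. \<Sum>k\<in>I. cnj (Q j k) * L j k)
        = (w - t) / of_real S * of_real S - (\<Sum>j\<in>I. L j j) / of_real m"
      by (simp add: sum_subtractf sum_distrib_left[symmetric] sum_divide_distrib[symmetric] S_def
          del: of_real_power)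
    then show ?thesis
      using S L_trace by simp
  qed
  have Q_norm: "(\<Sum>j\<in>I. \<Sum>k\<in>I. (cmod (Q j k))\<^sup>2) = (m - 1) / m"
  proof -
    define p where "p j = (cmod (v j))\<^sup>2 / S" for j
    have p_sum: "(\<Sum>j\<in>I. p j) = 1"
      using S by (simp add: p_def S_def[symmetric] sum_divide_distrib[symmetric])
    \<comment> \<open>The products \<open>p j * p k\<close> add up to 1, and the diagonal
      corrections to 1/m - 2/m.\<close>
    have "(cmod (Q j k))\<^sup>2 = p j * p k + (if j = k then 1 / m\<^sup>2 - 2 / m * p k else 0)" for j k
    proof (cases "j = k")
      case True
      have "Q j k = of_real (p k - 1 / m)"
        using True by (simp add: Q_def p_def complex_norm_square del: of_real_power)
      then have "(cmod (Q j k))\<^sup>2 = (p k - 1 / m)\<^sup>2"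
        by (simp only: norm_of_real power2_abs)
      then show ?thesis
        using True by (simp add: power2_eq_square algebra_simps)
    next
      case False
      then show ?thesis
        using S by (simp add: Q_def p_def norm_mult norm_divide power_mult_distrib power_divide power2_eq_square)
    qed
    then have "(\<Sum>j\<in>I. \<Sum>k\<in>I. (cmod (Q j k))\<^sup>2) = 1 + (m * (1 / m\<^sup>2) - 2 / m)"
      using fin by (simp add: sum.distrib sum_subtractf sum_distrib_left[symmetric]
          sum_divide_distrib[symmetric] p_sum m_def)
    then show ?thesis
      using m by (simp add: field_simps power2_eq_square)
  qed
  have L_norm: "(\<Sum>j\<in>I. \<Sum>k\<in>I. (cmod (L j k))\<^sup>2)
      = (\<Sum>j\<in>I. \<Sum>k\<in>I. (cmod (M j k))\<^sup>2) - (cmod tr)\<^sup>2 / m"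
  proof -
    have "(cmod (L j k))\<^sup>2 = (cmod (M j k))\<^sup>2
        + (if j = k then (cmod t)\<^sup>2 - 2 * Re (cnj t * M j k) else 0)" for j k
      by (simp add: L_def cmod_diff_squared_cnj)
    then have "(\<Sum>j\<in>I. \<Sum>k\<in>I. (cmod (L j k))\<^sup>2) = (\<Sum>j\<in>I. \<Sum>k\<in>I. (cmod (M j k))\<^sup>2)
        + (m * (cmod t)\<^sup>2 - 2 * Re (cnj t * tr))"
      using fin unfolding tr_def sum_distrib_left Re_sum
      by (simp only: sum.distrib sum.delta' sum.delta sum_subtractf sum_distrib_left[symmetric])
         (simp add: m_def sum.distrib sum_subtractf sum_distrib_left)
    \<comment> \<open>The cross term is twice the added \<open>m * (cmod t)\<^sup>2\<close>, so the
      net change is the subtraction of one such term, which is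
      \<open>(cmod tr)\<^sup>2 / m\<close>.\<close>
    also have "Re (cnj t * tr) = m * (cmod t)\<^sup>2"
      unfolding tr cmod_power2 by (simp add: power2_eq_square algebra_simps)
    finally show ?thesis
      using m by (simp add: tr norm_mult power_mult_distrib power2_eq_square)
  qed
  have "(cmod (w - t))\<^sup>2 \<le> (\<Sum>j\<in>I. \<Sum>k\<in>I. (cmod (Q j k))\<^sup>2) * (\<Sum>j\<in>I. \<Sum>k\<in>I. (cmod (L j k))\<^sup>2)"
    using Cauchy_Schwarz_sum_norm[of "\<lambda>(j, k). cnj (Q j k)" "\<lambda>(j, k). L j k" "I \<times> I"]
    unfolding inner[symmetric] sum.cartesian_product by (simp add: case_prod_unfold)
  then show ?thesis
    by (simp add: Q_norm L_norm t_def tr_def)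
qed

text \<open>By the matrix determinant lemma, \<open>root\<close> says that the characteristic
  polynomial of diag(d) + b 1^T vanishes at \<open>w\<close>. An eigenvector is written down
  explicitly, so no determinants enter; the cases count how often \<open>w\<close> occurs on the
  diagonal.\<close>

lemma diagonal_plus_rank_one_eigenvector:
  fixes d b :: "'a \<Rightarrow> complex"
  assumes fin: "finite I"
    and root: "(\<Prod>j\<in>I. w - d j) = (\<Sum>k\<in>I. b k * (\<Prod>j\<in>I - {k}. w - d j))"
  obtains v where "\<exists>j\<in>I. v j \<noteq> 0"
    and "\<And>j. j \<in> I \<Longrightarrow> d j * v j + b j * (\<Sum>k\<in>I. v k) = w * v j"
proof -
  have quotient: "d j * (b j / (w - d j)) + b j = w * (b j / (w - d j))" if "d j \<noteq> w" for j
    using that by (simp add: field_simps)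
  consider (none) "\<forall>j\<in>I. d j \<noteq> w"
    | (many) a c where "a \<in> I" "c \<in> I" "a \<noteq> c" "d a = w" "d c = w"
    | (one) a where "a \<in> I" "d a = w" "\<forall>j\<in>I - {a}. d j \<noteq> w"
    by blast
  then show thesis
  proof cases
    case none
    \<comment> \<open>This solves the eigenvector equation under the normalisation that the entries
      of \<open>v\<close> sum to 1; \<open>root\<close> divided by the full product is exactly that
      normalisation.\<close>
    define v where "v j = b j / (w - d j)" for j
    have "(\<Prod>j\<in>I. w - d j) = (\<Sum>k\<in>I. v k * (\<Prod>j\<in>I. w - d j))"
      unfolding root
    proof (intro sum.cong refl)
      fix k assume "k \<in> I"
      then show "b k * (\<Prod>j\<in>I - {k}. w - d j) = v k * (\<Sum>k\<in>I. b k * (\<Prod>j\<in>I - {k}. w - d j))"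
        unfolding root[symmetric] using none fin by (subst (2) prod.remove[of _ k]) (auto simp: v_def)
    qed
    moreover have "(\<Prod>j\<in>I. w - d j) \<noteq> 0"
      using none fin by auto
    ultimately have sum: "(\<Sum>k\<in>I. v k) = 1"
      by (simp add: sum_distrib_right[symmetric])
    then have "\<exists>j\<in>I. v j \<noteq> 0"
      by (metis sum.neutral zero_neq_one)
    moreover have "d j * v j + b j * (\<Sum>k\<in>I. v k) = w * v j" if "j \<in> I" for j
      unfolding sum using that none quotient by (simp add: v_def)
    ultimately show thesis
      by (rule that)
  next
    case many
    \<comment> \<open>The difference of two unit vectors has entry sum 0, so the rank-one part kills
      it and only the diagonal, equal to \<open>w\<close> at both places, acts.\<close>
    define v :: "'a \<Rightarrow> complex" where "v j = (if j = a then 1 else 0) - (if j = c then 1 else 0)" for j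
    have "(\<Sum>k\<in>I. v k) = 0"
      using many fin by (simp add: v_def sum_subtractf)
    then show thesis
      using many by (intro that[of v]) (auto simp: v_def)
  next
    case one
    \<comment> \<open>Only the summand for \<open>a\<close> omits the vanishing factor
      \<open>w - d a\<close>, which forces \<open>b a = 0\<close>.\<close>
    have "0 = (\<Sum>k\<in>I. b k * (\<Prod>j\<in>I - {k}. w - d j))"
      using root one fin by (metis prod_zero right_minus_eq)
    also have "\<dots> = b a * (\<Prod>j\<in>I - {a}. w - d j) + (\<Sum>k\<in>I - {a}. b k * (\<Prod>j\<in>I - {k}. w - d j))"
      using one fin by (simp add: sum.remove)
    also have "(\<Sum>k\<in>I - {a}. b k * (\<Prod>j\<in>I - {k}. w - d j)) = 0"
      using one fin by (intro sum.neutral ballI) (auto intro!: bexI[of _ a])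
    finally have b: "b a = 0"
      using one fin by auto
    define u where "u j = b j / (w - d j)" for j
    \<comment> \<open>Row \<open>a\<close> now holds for any value of \<open>v a\<close>, which is
      therefore free to bring the entry sum to 1.\<close>
    define v where "v j = (if j = a then 1 - (\<Sum>k\<in>I - {a}. u k) else u j)" for j
    have "(\<Sum>k\<in>I. v k) = v a + (\<Sum>k\<in>I - {a}. u k)"
      using one fin by (subst sum.remove[of _ a]) (auto simp: v_def)
    then have sum: "(\<Sum>k\<in>I. v k) = 1"
      by (simp add: v_def)
    then have "\<exists>j\<in>I. v j \<noteq> 0"
      by (metis sum.neutral zero_neq_one)
    moreover have "d j * v j + b j * (\<Sum>k\<in>I. v k) = w * v j" if "j \<in> I" for j
      unfolding sum using that one b quotient by (cases "j = a") (auto simp: v_def u_def)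
    ultimately show thesis
      by (rule that)
  qed
qed

text \<open>Writing \<open>w - z n\<close> as \<open>(w - z k) - (z n - z k)\<close> in the summand
  for k < n splits off \<gamma> k times the full product over \<open>I\<close>; together with the
  summand for \<open>n\<close>, these weights add up to 1. The result is the hypothesis
  \<open>root\<close> of the eigenvector lemma.\<close>

lemma weighted_incomplete_poly_root:
  fixes n :: nat and z :: "nat \<Rightarrow> complex"
  assumes n: "n \<ge> 1"
    and sum: "(\<Sum>k=1..n. \<gamma> k) = 1"
    and root: "poly (weighted_incomplete_poly n \<gamma> z) w = 0"
  defines "I \<equiv> {1..n - 1}"
  shows "(\<Prod>j\<in>I. w - z j)
    = (\<Sum>k\<in>I. of_real (\<gamma> k) * (z n - z k) * (\<Prod>j\<in>I - {k}. w - z j))"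
proof -
  have ins: "{1..n} = insert n I" and notin: "n \<notin> I" and fin: "finite I"
    using n by (auto simp: I_def)
  define P where "P k = (\<Prod>j\<in>I - {k}. w - z j)" for k
  define A where "A = (\<Prod>j\<in>I. w - z j)"
  have "0 = (\<Sum>k\<in>insert n I. of_real (\<gamma> k) * (\<Prod>j\<in>insert n I - {k}. w - z j))"
    using root unfolding weighted_incomplete_poly_def incomplete_poly_def ins
    by (simp add: poly_sum poly_prod)
  also have "\<dots> = of_real (\<gamma> n) * A + (\<Sum>k\<in>I. of_real (\<gamma> k) * ((w - z n) * P k))"
  proof -
    have "(\<Prod>j\<in>insert n I - {k}. w - z j) = (w - z n) * P k" if "k \<in> I" for k
      using that notin fin by (auto simp: P_def insert_Diff_if)
    then show ?thesis
      using notin fin by (simp add: A_def)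
  qed
  also have "(\<Sum>k\<in>I. of_real (\<gamma> k) * ((w - z n) * P k))
      = (\<Sum>k\<in>I. of_real (\<gamma> k) * A - of_real (\<gamma> k) * (z n - z k) * P k)"
  proof (intro sum.cong refl)
    fix k assume "k \<in> I"
    then have A: "A = (w - z k) * P k"
      using fin by (simp add: A_def P_def prod.remove)
    show "of_real (\<gamma> k) * ((w - z n) * P k)
        = of_real (\<gamma> k) * A - of_real (\<gamma> k) * (z n - z k) * P k"
      unfolding A by (simp add: algebra_simps)
  qed
  also have "of_real (\<gamma> n) * A + \<dots>
      = of_real (\<Sum>k=1..n. \<gamma> k) * A - (\<Sum>k\<in>I. of_real (\<gamma> k) * (z n - z k) * P k)"
    using notin fin unfolding ins
    by (simp add: sum_subtractf sum.distrib sum_distrib_left algebra_simps)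
  finally show ?thesis
    unfolding sum by (simp add: A_def P_def)
qed

theorem theorem6p4:
  fixes n :: nat and z :: "nat \<Rightarrow> complex" and \<gamma> :: "nat \<Rightarrow> real" and w :: complex
  assumes "n \<ge> 2"
    and "\<And>k. k \<in> {1..n} \<Longrightarrow> \<gamma> k \<ge> 0"
    and "(\<Sum>k=1..n. \<gamma> k) = 1"
    and "poly (weighted_incomplete_poly n \<gamma> z) w = 0"
  shows "cmod (w - (\<Sum>j=1..n. of_real (1 - \<gamma> j) * z j) / of_real (real n - 1))
    \<le> sqrt ((real n - 2) / (real n - 1)) *
       sqrt ((\<Sum>j=1..n - 1. (cmod (of_real (1 - \<gamma> j) * z j + of_real (\<gamma> j) * z n))\<^sup>2)
         + (real n - 2) * (\<Sum>j=1..n - 1. (\<gamma> j)\<^sup>2 * (cmod (z n - z j))\<^sup>2)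
         - (cmod (\<Sum>j=1..n. of_real (1 - \<gamma> j) * z j))\<^sup>2 / (real n - 1))"
proof -
  define I where "I = {1..n - 1}"
  have fin: "finite I" and notin: "n \<notin> I" and ins: "{1..n} = insert n I"
    and card: "real (card I) = real n - 1"
    using assms(1) by (auto simp: I_def of_nat_diff)
  define b where "b j = of_real (\<gamma> j) * (z n - z j)" for j
  define M where "M j k = (if j = k then z j else 0) + b j" for j k
  have "(\<Prod>j\<in>I. w - z j) = (\<Sum>k\<in>I. b k * (\<Prod>j\<in>I - {k}. w - z j))"
    using weighted_incomplete_poly_root[of n \<gamma> z w] assms by (simp add: I_def b_def)
  then obtain v where v: "\<exists>j\<in>I. v j \<noteq> 0"
    "\<And>j. j \<in> I \<Longrightarrow> z j * v j + b j * (\<Sum>k\<in>I. v k) = w * v j"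
    using diagonal_plus_rank_one_eigenvector[OF fin] by blast
  have eigen: "(\<Sum>k\<in>I. M j k * v k) = w * v j" if "j \<in> I" for j
  proof -
    have "(\<Sum>k\<in>I. M j k * v k) = (\<Sum>k\<in>I. (if j = k then z k * v k else 0) + b j * v k)"
      by (intro sum.cong) (auto simp: M_def algebra_simps)
    then show ?thesis
      using that fin v(2) by (simp add: sum.distrib sum_distrib_left)
  qed
  have diag: "M j j = of_real (1 - \<gamma> j) * z j + of_real (\<gamma> j) * z n" for j
    by (simp add: M_def b_def algebra_simps)
  \<comment> \<open>The weights over \<open>I\<close> sum to \<open>1 - \<gamma> n\<close>, so the
    copies of \<open>z n\<close> on the diagonal supply the missing summand for
    \<open>n\<close>.\<close>
  have trace: "(\<Sum>j\<in>I. M j j) = (\<Sum>j=1..n. of_real (1 - \<gamma> j) * z j)"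
  proof -
    have "(\<Sum>j\<in>I. \<gamma> j) = 1 - \<gamma> n"
      using assms(3) fin notin unfolding ins by simp
    then have "(\<Sum>j\<in>I. of_real (\<gamma> j) * z n) = of_real (1 - \<gamma> n) * z n"
      by (metis of_real_sum sum_distrib_right)
    then show ?thesis
      using fin notin by (simp only: diag sum.distrib ins sum.insert if_False add.commute not_False_eq_True)
  qed
  have frobenius: "(\<Sum>j\<in>I. \<Sum>k\<in>I. (cmod (M j k))\<^sup>2)
      = (\<Sum>j\<in>I. (cmod (of_real (1 - \<gamma> j) * z j + of_real (\<gamma> j) * z n))\<^sup>2)
        + (real n - 2) * (\<Sum>j\<in>I. (\<gamma> j)\<^sup>2 * (cmod (z n - z j))\<^sup>2)"
  proof -
    have "(\<Sum>k\<in>I. (cmod (M j k))\<^sup>2)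
        = (cmod (M j j))\<^sup>2 + (real n - 2) * ((\<gamma> j)\<^sup>2 * (cmod (z n - z j))\<^sup>2)" if "j \<in> I" for j
    proof -
      \<comment> \<open>Off the diagonal, row \<open>j\<close> is constantly \<open>b j\<close>; its
        \<open>n - 2\<close> such entries give the factor in the bound.\<close>
      have "(\<Sum>k\<in>I. (cmod (M j k))\<^sup>2) = (cmod (M j j))\<^sup>2 + (\<Sum>k\<in>I - {j}. (cmod (b j))\<^sup>2)"
        using that fin by (simp add: sum.remove M_def)
      moreover have "real (card (I - {j})) = real n - 2"
        using that fin assms(1) by (simp add: I_def of_nat_diff)
      ultimately show ?thesis
        by (simp add: b_def norm_mult power_mult_distrib)
    qed
    then show ?thesis
      by (simp add: sum.distrib sum_distrib_left diag)
  qed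
  have "(cmod (w - (\<Sum>j\<in>I. M j j) / of_real (real n - 1)))\<^sup>2 \<le> (real n - 2) / (real n - 1) *
      ((\<Sum>j\<in>I. \<Sum>k\<in>I. (cmod (M j k))\<^sup>2) - (cmod (\<Sum>j\<in>I. M j j))\<^sup>2 / (real n - 1))"
    using eigenvalue_dist_trace[OF fin eigen v(1)] by (simp add: card)
  then show ?thesis
    unfolding trace frobenius real_sqrt_mult[symmetric] unfolding I_def by (rule real_le_rsqrt)
qed

end
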